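(* Let $\mathcal{X}$ be a set, $N\ge1$, and let $f_1,\dots,f_N:\mathcal{X}\to[0,1]$ be experts. Let $T\ge 1$, and let $x_1,\dots,x_T\in\mathcal{X}$ and $y_1,\dots,y_T\in\{0,1\}$ be arbitrary ($x_t$ revealed before $p_t$ is chosen, $y_t$ revealed after). Let $p_1,\dots,p_T\in[0,1]$ be the predictions of the $\ell_\infty$ Defensive Forecasting algorithm run with $$F_j(x,p,y)=\lambda\big\{(p-y)^2-(f_j(x)-y)^2\big\},\qquad j=1,\dots,N,$$ with $\lambda=2$. Then $$\frac1T\sum_{t=1}^T(p_t-y_t)^2-\inf_{1\le j\le N}\frac1T\sum_{t=1}^T(f_j(x_t)-y_t)^2\le\frac{\log N}{2T}.$$
   Context: Anticorrelation search: given a function $S:[0,1]\to\mathbb{R}$, return $p=1$ if $S(1)\ge 0$; otherwise return $p=0$ if $S(0)\le 0$; otherwise return some $p\in[0,1]$ with $S(p)=0$ (exact root finding). $\ell_\infty$ Defensive Forecasting with functions $F_1,\dots,F_N$: at each round $t$, set $Q_{jt}=\sum_{s=1}^{t-1}F_j(x_s,p_s,y_s)$ (so $Q_{j1}=0$), $\alpha_{jt}=\exp(Q_{jt})/\sum_{i=1}^N\exp(Q_{it})$, and $$S_t(p)=\sum_{j=1}^N\alpha_{jt}\exp\big(F_j(x_t,p,1)\big)-\sum_{j=1}^N\alpha_{jt}\exp\big(F_j(x_t,p,0)\big),$$ let $p_t$ be the output of anticorrelation search on $S_t$, and then observe $y_t$. *)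

theory Defs
  imports Complex_Main
begin

text \<open>Exact root finding may have several admissible answers, so anticorrelation search is the
  relation ``\<open>p\<close> is a possible output on input \<open>S\<close>''. Only the values of \<open>S\<close> on \<open>[0,1]\<close> matter.\<close>

definition anticorrelation_search :: "(real \<Rightarrow> real) \<Rightarrow> real \<Rightarrow> bool" where
  "anticorrelation_search S p \<longleftrightarrow>
     (if S 1 \<ge> 0 then p = 1
      else if S 0 \<le> 0 then p = 0
      else p \<in> {0..1} \<and> S p = 0)"

lemma anticorrelation_search_total:
  assumes "continuous_on {0..1} S"
  shows "\<exists>p. anticorrelation_search S p"
proof (cases "S 1 \<ge> 0 \<or> S 0 \<le> 0")
  case True
  then show ?thesis by (auto simp: anticorrelation_search_def)
next
  case False
  then obtain p where "0 \<le> p" "p \<le> 1" "S p = 0"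
    using IVT2'[of S 1 0 0] assms by auto
  then show ?thesis using False by (auto simp: anticorrelation_search_def)
qed

lemma anticorrelation_search_range:
  "anticorrelation_search S p \<Longrightarrow> p \<in> {0..1}"
  by (auto simp: anticorrelation_search_def split: if_splits)

text \<open>In what follows \<open>F j x p y\<close> is \<open>F\<^sub>j(x,p,y)\<close>, and \<open>x t\<close>, \<open>p t\<close>, \<open>y t\<close> are the context,
  prediction and outcome of round \<open>t\<close>. Functions and rounds are numbered from 1.\<close>

definition df_score ::
  "(nat \<Rightarrow> 'x \<Rightarrow> real \<Rightarrow> real \<Rightarrow> real) \<Rightarrow> (nat \<Rightarrow> 'x) \<Rightarrow> (nat \<Rightarrow> real) \<Rightarrow> (nat \<Rightarrow> real) \<Rightarrow>
    nat \<Rightarrow> nat \<Rightarrow> real" where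
  "df_score F x p y t j = (\<Sum>s\<in>{1..<t}. F j (x s) (p s) (y s))"

definition df_weight ::
  "nat \<Rightarrow> (nat \<Rightarrow> 'x \<Rightarrow> real \<Rightarrow> real \<Rightarrow> real) \<Rightarrow> (nat \<Rightarrow> 'x) \<Rightarrow> (nat \<Rightarrow> real) \<Rightarrow> (nat \<Rightarrow> real) \<Rightarrow>
    nat \<Rightarrow> nat \<Rightarrow> real" where
  "df_weight N F x p y t j =
     exp (df_score F x p y t j) / (\<Sum>i\<in>{1..N}. exp (df_score F x p y t i))"

definition df_S ::
  "nat \<Rightarrow> (nat \<Rightarrow> 'x \<Rightarrow> real \<Rightarrow> real \<Rightarrow> real) \<Rightarrow> (nat \<Rightarrow> 'x) \<Rightarrow> (nat \<Rightarrow> real) \<Rightarrow> (nat \<Rightarrow> real) \<Rightarrow>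
    nat \<Rightarrow> real \<Rightarrow> real" where
  "df_S N F x p y t q =
     (\<Sum>j\<in>{1..N}. df_weight N F x p y t j * exp (F j (x t) q 1))
     - (\<Sum>j\<in>{1..N}. df_weight N F x p y t j * exp (F j (x t) q 0))"

text \<open>\<open>p\<close> is a possible sequence of predictions over rounds \<open>1,\<dots>,T\<close> on the data \<open>x\<close>, \<open>y\<close>.
  The function \<open>df_S N F x p y t\<close> uses \<open>p s\<close> and \<open>y s\<close> only for \<open>s < t\<close>, so this respects the
  order of revelation; since it is a property of the realised sequences, it covers data chosen
  adaptively as well.\<close>

definition linf_defensive_forecasting ::
  "nat \<Rightarrow> (nat \<Rightarrow> 'x \<Rightarrow> real \<Rightarrow> real \<Rightarrow> real) \<Rightarrow> nat \<Rightarrow> (nat \<Rightarrow> 'x) \<Rightarrow> (nat \<Rightarrow> real) \<Rightarrow>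
    (nat \<Rightarrow> real) \<Rightarrow> bool" where
  "linf_defensive_forecasting N F T x y p \<longleftrightarrow>
     (\<forall>t\<in>{1..T}. anticorrelation_search (df_S N F x p y t) (p t))"

definition expert_regret_fun ::
  "real \<Rightarrow> (nat \<Rightarrow> 'x \<Rightarrow> real) \<Rightarrow> nat \<Rightarrow> 'x \<Rightarrow> real \<Rightarrow> real \<Rightarrow> real" where
  "expert_regret_fun l f j x p y = l * ((p - y)\<^sup>2 - (f j x - y)\<^sup>2)"

end

(* Each round multiplies the total weight of the experts by the mixture of the exp F_j(x_t,p_t,y_t)
   under the current weights. This mixture is at most 1: if the search returns an endpoint, the
   mixture at the favourable outcome has nonpositive exponents and dominates the other one; if it
   returns a root p, the mixtures at both outcomes agree, so each equals the average over an outcome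
   drawn with probability p, which Hoeffding's lemma bounds by 1 for lambda = 2. Hence the
   total weight never exceeds N. *)
theory Submission
  imports Defs "HOL-Probability.Hoeffding"
begin

text \<open>Hoeffding's lemma for \<open>Y - q\<close> with \<open>Y\<close> Bernoulli of mean
  \<open>q\<close>: the left side is its moment generating function at \<open>h\<close>. Taking
  logarithms gives the function bounded in \<open>Hoeffdings_lemma_aux\<close>, for nonnegative
  \<open>h\<close>.\<close>

lemma bernoulli_mgf_le:
  fixes h q :: real
  assumes "0 \<le> q" "q \<le> 1"
  shows "q * exp (h * (1 - q)) + (1 - q) * exp (- (h * q)) \<le> exp (h\<^sup>2 / 8)"
proof -
  have nonneg: "q * exp (h * (1 - q)) + (1 - q) * exp (- (h * q)) \<le> exp (h\<^sup>2 / 8)"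
    if "0 \<le> h" "0 \<le> q" for h q :: real
  proof -
    have pos: "1 + q * (exp h - 1) > 0"
      using that by (intro add_pos_nonneg mult_nonneg_nonneg) auto
    have "q * exp (h * (1 - q)) + (1 - q) * exp (- (h * q))
        = exp (- h * q) * (1 + q * (exp h - 1))"
      by (simp add: algebra_simps exp_diff exp_minus field_simps)
    also have "\<dots> = exp (- h * q + ln (1 + q * (exp h - 1)))"
      using pos by (simp only: exp_add exp_ln)
    also have "\<dots> \<le> exp (h\<^sup>2 / 8)"
      using Hoeffdings_lemma_aux[OF that] by simp
    finally show ?thesis .
  qed
  show ?thesis
  proof (cases "h \<ge> 0")
    case True
    then show ?thesis using nonneg assms by blast
  next
    case False
    \<comment> \<open>Exchanging the two outcomes replaces \<open>h\<close>, \<open>q\<close> by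
      \<open>- h\<close>, \<open>1 - q\<close> and leaves the left side unchanged.\<close>
    then show ?thesis
      using nonneg[of "- h" "1 - q"] assms by (simp add: algebra_simps)
  qed
qed

lemma expert_regret_fun_average_le_one:
  assumes "0 \<le> q" "q \<le> 1"
  shows "q * exp (expert_regret_fun 2 f j z q 1)
       + (1 - q) * exp (expert_regret_fun 2 f j z q 0) \<le> 1"
proof -
  \<comment> \<open>For a general factor \<lambda> the exponents have linear part from
    \<open>h = 2 * \<lambda> * (f j z - q)\<close> and quadratic part
    \<open>- \<lambda> * (f j z - q)\<^sup>2\<close>. At \<lambda> = 2 the latter is exactly
    \<open>- h\<^sup>2 / 8\<close>, which cancels Hoeffding's bound.\<close>
  define h where "h = 4 * (f j z - q)"
  have "expert_regret_fun 2 f j z q 1 = h * (1 - q) - h\<^sup>2 / 8"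
    and "expert_regret_fun 2 f j z q 0 = - (h * q) - h\<^sup>2 / 8"
    by (simp_all add: expert_regret_fun_def h_def power2_eq_square field_simps)
  then have "q * exp (expert_regret_fun 2 f j z q 1)
      + (1 - q) * exp (expert_regret_fun 2 f j z q 0)
      = (q * exp (h * (1 - q)) + (1 - q) * exp (- (h * q))) / exp (h\<^sup>2 / 8)"
    by (simp add: exp_diff add_divide_distrib)
  also have "\<dots> \<le> 1"
    using bernoulli_mgf_le[OF assms] by (simp add: divide_le_eq_1)
  finally show ?thesis .
qed

text \<open>One round, with the weights abstracted to any probability vector. The bound is proved
  for both outcomes at once, so it holds whatever is revealed after \<open>p\<close>.\<close>

lemma anticorrelation_search_mixture_le_one:
  fixes a :: "nat \<Rightarrow> real"
  assumes search: "anticorrelation_search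
      (\<lambda>q. (\<Sum>j\<in>I. a j * exp (expert_regret_fun 2 f j z q 1))
         - (\<Sum>j\<in>I. a j * exp (expert_regret_fun 2 f j z q 0))) p"
    and a_nonneg: "\<And>j. j \<in> I \<Longrightarrow> 0 \<le> a j" and a_sum: "sum a I = 1"
    and y: "y \<in> {0, 1}"
  shows "(\<Sum>j\<in>I. a j * exp (expert_regret_fun 2 f j z p y)) \<le> 1"
proof -
  define A where "A q o' = (\<Sum>j\<in>I. a j * exp (expert_regret_fun 2 f j z q o'))" for q o'
  have mixture: "(\<Sum>j\<in>I. a j * g j) \<le> 1" if "\<And>j. g j \<le> 1" for g :: "nat \<Rightarrow> real"
  proof -
    have "(\<Sum>j\<in>I. a j * g j) \<le> (\<Sum>j\<in>I. a j * 1)"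
      using that a_nonneg by (intro sum_mono mult_left_mono)
    then show ?thesis using a_sum by simp
  qed
  \<comment> \<open>When the prediction equals the outcome its loss is 0, so each exponent is minus
    twice an expert's squared loss.\<close>
  have end_points: "A 1 1 \<le> 1" "A 0 0 \<le> 1"
    unfolding A_def by (intro mixture; simp add: expert_regret_fun_def)+
  consider "A 1 0 \<le> A 1 1" "p = 1" | "A 0 1 \<le> A 0 0" "p = 0"
    | "0 \<le> p" "p \<le> 1" "A p 1 = A p 0"
    using search by (auto simp: anticorrelation_search_def A_def split: if_splits)
  then have "A p 0 \<le> 1 \<and> A p 1 \<le> 1"
  proof cases
    case 3
    have "p * A p 1 + (1 - p) * A p 0
        = (\<Sum>j\<in>I. a j * (p * exp (expert_regret_fun 2 f j z p 1)
            + (1 - p) * exp (expert_regret_fun 2 f j z p 0)))"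
      by (simp add: A_def sum_distrib_left sum.distrib[symmetric] algebra_simps)
    also have "\<dots> \<le> 1"
      using 3 by (intro mixture expert_regret_fun_average_le_one)
    finally show ?thesis using 3 by (simp add: algebra_simps)
  qed (use end_points in auto)
  then show ?thesis using y by (auto simp: A_def)
qed

text \<open>A potential argument valid for every \<open>F\<close>: before round 1 all scores are
  empty sums, so the total weight starts at \<open>N\<close>, and no round increases it.\<close>

lemma df_total_weight_le:
  assumes "\<And>t. t \<in> {1..T} \<Longrightarrow>
      (\<Sum>j\<in>{1..N}. df_weight N F x p y t j * exp (F j (x t) (p t) (y t))) \<le> 1"
  shows "(\<Sum>j\<in>{1..N}. exp (df_score F x p y (Suc T) j)) \<le> real N"
  using assms
proof (induction T)
  case 0
  then show ?case by (simp add: df_score_def)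
next
  case (Suc T)
  let ?W = "\<Sum>j\<in>{1..N}. exp (df_score F x p y (Suc T) j)"
  let ?g = "\<lambda>j. exp (F j (x (Suc T)) (p (Suc T)) (y (Suc T)))"
  show ?case
  proof (cases "N = 0")
    case False
    then have W_pos: "?W > 0" by (intro sum_pos) auto
    have "(\<Sum>j\<in>{1..N}. exp (df_score F x p y (Suc (Suc T)) j))
        = (\<Sum>j\<in>{1..N}. exp (df_score F x p y (Suc T) j) * ?g j)"
      by (simp add: df_score_def exp_add)
    \<comment> \<open>\<open>?W\<close> is the normaliser of \<open>df_weight\<close> in round
      \<open>Suc T\<close>; it cancels because it is nonzero.\<close>
    also have "\<dots> = ?W * (\<Sum>j\<in>{1..N}. df_weight N F x p y (Suc T) j * ?g j)"
      using W_pos by (simp add: df_weight_def sum_distrib_left)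
    also have "\<dots> \<le> ?W * 1"
      using W_pos Suc.prems[of "Suc T"] by (intro mult_left_mono) auto
    also have "\<dots> \<le> real N"
      using Suc by simp
    finally show ?thesis .
  qed simp
qed

lemma df_weight_sum:
  assumes "N \<ge> 1"
  shows "(\<Sum>j\<in>{1..N}. df_weight N F x p y t j) = 1"
proof -
  have "(\<Sum>j\<in>{1..N}. exp (df_score F x p y t j)) > 0"
    using assms by (intro sum_pos) auto
  then show ?thesis
    by (simp add: df_weight_def sum_divide_distrib[symmetric])
qed

theorem mainTheorem5:
  fixes X :: "'x set" and N T :: nat
    and f :: "nat \<Rightarrow> 'x \<Rightarrow> real"
    and x :: "nat \<Rightarrow> 'x" and y p :: "nat \<Rightarrow> real"
  assumes "N \<ge> 1" and "T \<ge> 1"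
    and "\<And>j z. j \<in> {1..N} \<Longrightarrow> z \<in> X \<Longrightarrow> f j z \<in> {0..1}"
    and "\<And>t. t \<in> {1..T} \<Longrightarrow> x t \<in> X"
    and "\<And>t. t \<in> {1..T} \<Longrightarrow> y t \<in> {0, 1}"
    and "linf_defensive_forecasting N (expert_regret_fun 2 f) T x y p"
  shows "(1 / real T) * (\<Sum>t\<in>{1..T}. (p t - y t)\<^sup>2)
       - (INF j\<in>{1..N}. (1 / real T) * (\<Sum>t\<in>{1..T}. (f j (x t) - y t)\<^sup>2))
       \<le> ln (real N) / (2 * real T)"
proof -
  let ?F = "expert_regret_fun 2 f"
  have mixture: "(\<Sum>j\<in>{1..N}. df_weight N ?F x p y t j * exp (?F j (x t) (p t) (y t))) \<le> 1"
    if "t \<in> {1..T}" for t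
  proof (rule anticorrelation_search_mixture_le_one)
    show "anticorrelation_search
      (\<lambda>q. (\<Sum>j\<in>{1..N}. df_weight N ?F x p y t j * exp (?F j (x t) q 1))
         - (\<Sum>j\<in>{1..N}. df_weight N ?F x p y t j * exp (?F j (x t) q 0))) (p t)"
      using assms(6) that by (simp add: linf_defensive_forecasting_def df_S_def[abs_def])
    show "0 \<le> df_weight N ?F x p y t j" for j
      unfolding df_weight_def by (intro divide_nonneg_nonneg sum_nonneg) auto
  qed (fact df_weight_sum[OF assms(1)], fact assms(5)[OF that])
  have regret: "(1 / real T) * (\<Sum>t\<in>{1..T}. (p t - y t)\<^sup>2) - ln (real N) / (2 * real T)
      \<le> (1 / real T) * (\<Sum>t\<in>{1..T}. (f j (x t) - y t)\<^sup>2)" if "j \<in> {1..N}" for j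
  proof -
    have "exp (df_score ?F x p y (Suc T) j) \<le> (\<Sum>j\<in>{1..N}. exp (df_score ?F x p y (Suc T) j))"
      using that by (intro member_le_sum) auto
    also have "\<dots> \<le> real N"
      using mixture by (rule df_total_weight_le)
    finally have "df_score ?F x p y (Suc T) j \<le> ln (real N)"
      using assms(1) by (simp add: ln_ge_iff)
    \<comment> \<open>The score at \<open>Suc T\<close> covers exactly rounds 1 to \<open>T\<close>.
      Its factor 2 becomes the 2 in the denominator of the final bound.\<close>
    moreover have "df_score ?F x p y (Suc T) j
        = 2 * ((\<Sum>t\<in>{1..T}. (p t - y t)\<^sup>2) - (\<Sum>t\<in>{1..T}. (f j (x t) - y t)\<^sup>2))"
      by (simp add: df_score_def expert_regret_fun_def sum_distrib_left sum_subtractf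
          atLeastLessThanSuc_atLeastAtMost)
    ultimately have "(\<Sum>t\<in>{1..T}. (p t - y t)\<^sup>2) - ln (real N) / 2
        \<le> (\<Sum>t\<in>{1..T}. (f j (x t) - y t)\<^sup>2)"
      by simp
    then show ?thesis
      using divide_right_mono[of _ _ "real T"] by (fastforce simp: diff_divide_distrib)
  qed
  \<comment> \<open>The left side is free of \<open>j\<close>, so it is a lower bound for all
    experts' average losses and hence for their infimum.\<close>
  have "(1 / real T) * (\<Sum>t\<in>{1..T}. (p t - y t)\<^sup>2) - ln (real N) / (2 * real T)
      \<le> (INF j\<in>{1..N}. (1 / real T) * (\<Sum>t\<in>{1..T}. (f j (x t) - y t)\<^sup>2))"
    using assms(1) regret by (intro cINF_greatest) auto
  then show ?thesis by simp
qed

end
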